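(* Let $\mathsf{G}$ be a finite abelian group with neutral element $e$, let $\mathbb{F}$ be an algebraically closed field of characteristic zero, and let $\mathfrak{A}=\bigoplus_{\xi\in\mathsf{G}}\mathfrak{A}_\xi$ be any associative $\mathsf{G}$-graded $\mathbb{F}$-algebra. If $\mathfrak{A}_e$ satisfies a polynomial identity of degree $2$, then either $\mathfrak{A}$ is a nilpotent algebra or $\mathfrak{A}_e$ is a commutative algebra.
   Context: Algebras are associative and not necessarily unital. A $\mathsf{G}$-grading means $\mathfrak{A}=\bigoplus_{\xi\in\mathsf{G}}\mathfrak{A}_\xi$ with subspaces satisfying $\mathfrak{A}_\xi\mathfrak{A}_\zeta\subseteq\mathfrak{A}_{\xi\zeta}$. A polynomial in non-commuting variables has degree $2$ if it is of the form $g(x_1,\dots,x_n)=\sum_{r,s}\lambda_{rs}x_rx_s+\sum_k\gamma_kx_k$ with $\lambda_{rs},\gamma_k\in\mathbb{F}$ and some $\lambda_{rs}\neq0$ (no constant term). $\mathfrak{A}_e$ satisfies the polynomial identity $g$ if $g(a_1,\dots,a_n)=0$ for all $a_i\in\mathfrak{A}_e$. $\mathfrak{A}$ is nilpotent if $\mathfrak{A}^k=\{0\}$ for some $k\geq1$. *)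

theory Defs
  imports Complex_Main "HOL-Computational_Algebra.Polynomial"
begin

text \<open>
  Associative, not necessarily unital algebras over a field: the type class \<open>ring\<close> provides
  an associative multiplication without a unit.
\<close>

locale assoc_algebra = vector_space scale
  for scale :: "'f :: field \<Rightarrow> 'a :: ring \<Rightarrow> 'a" (infixr \<open>*s\<close> 75) +
  assumes scale_mult_left: "(c *s x) * y = c *s (x * y)"
    and scale_mult_right: "x * (c *s y) = c *s (x * y)"
begin

text \<open>
  \<open>alg_power k\<close> is the power \<open>A\<^sup>k\<close> of the whole algebra, i.e. the span of all products of
  \<open>k\<close> elements. Only exponents \<open>k \<ge> 1\<close> are meaningful, as there is no unit.
\<close>

fun alg_power :: "nat \<Rightarrow> 'a set" where
  "alg_power 0 = UNIV"
| "alg_power (Suc 0) = UNIV"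
| "alg_power (Suc (Suc k)) = span {x * y | x y. x \<in> alg_power (Suc k) \<and> y \<in> UNIV}"

definition nilpotent :: bool where
  "nilpotent \<longleftrightarrow> (\<exists>k\<ge>1. alg_power k = {0})"

text \<open>
  The value at \<open>(a 1, \<dots>, a n)\<close> of the polynomial in \<open>n\<close> non-commuting variables
  with quadratic coefficients \<open>l r s\<close> (for \<open>x\<^sub>r x\<^sub>s\<close>), linear coefficients \<open>c k\<close>
  (for \<open>x\<^sub>k\<close>) and no constant term.
\<close>

definition eval_quadratic ::
    "nat \<Rightarrow> (nat \<Rightarrow> nat \<Rightarrow> 'f) \<Rightarrow> (nat \<Rightarrow> 'f) \<Rightarrow> (nat \<Rightarrow> 'a) \<Rightarrow> 'a" where
  "eval_quadratic n l c a =
     (\<Sum>r=1..n. \<Sum>s=1..n. l r s *s (a r * a s)) + (\<Sum>k=1..n. c k *s a k)"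

definition satisfies_degree2_identity :: "'a set \<Rightarrow> bool" where
  "satisfies_degree2_identity B \<longleftrightarrow>
     (\<exists>n l c. (\<exists>r\<in>{1..n}. \<exists>s\<in>{1..n}. l r s \<noteq> 0) \<and>
        (\<forall>a. (\<forall>i\<in>{1..n}. a i \<in> B) \<longrightarrow> eval_quadratic n l c a = 0))"

end

text \<open>
  The finite abelian grading group is written additively, with neutral element \<open>0\<close>.
\<close>

locale graded_algebra = assoc_algebra scale
  for scale :: "'f :: field \<Rightarrow> 'a :: ring \<Rightarrow> 'a" (infixr \<open>*s\<close> 75) +
  fixes A :: "'g :: {ab_group_add, finite} \<Rightarrow> 'a set"
  assumes subspace_component: "subspace (A g)"
    and direct_sum: "\<exists>!f. (\<forall>g. f g \<in> A g) \<and> x = (\<Sum>g\<in>UNIV. f g)"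
    and mult_component: "\<lbrakk>x \<in> A g; y \<in> A h\<rbrakk> \<Longrightarrow> x * y \<in> A (g + h)"

end

theory Submission
  imports Defs "HOL-Library.FuncSet"
begin

text \<open>
  Replacing all arguments \<open>a\<close> of the identity by \<open>- a\<close> and adding removes the linear terms, as
  the characteristic is not \<open>2\<close>. What remains is a quadratic form in non-commuting variables that
  vanishes on \<open>A 0\<close>. If one of its diagonal coefficients is nonzero, setting all other variables to
  \<open>0\<close> shows that \<open>x * x = 0\<close> on \<open>A 0\<close>. Otherwise some pair of distinct variables gives
  \<open>\<lambda> (x * y) + \<mu> (y * x) = 0\<close> with \<open>\<lambda> \<noteq> 0\<close>; for \<open>\<mu> = - \<lambda>\<close> this is commutativity, and for
  \<open>\<mu> \<noteq> - \<lambda>\<close> the choice \<open>y = x\<close> again yields \<open>x * x = 0\<close> (lemma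
  \<open>degree2_identity_imp_square_zero_or_commutative\<close>).

  It remains to see that \<open>x * x = 0\<close> on \<open>A 0\<close> makes the whole algebra nilpotent. Elements of square
  zero anticommute, and moving a factor past a product of two others in two different ways gives
  \<open>x * y * z = - (x * y * z)\<close>, so products of three elements of \<open>A 0\<close> vanish. Nilpotency then
  passes from \<open>A 0\<close> to the algebra by the pigeonhole principle: among the prefixes of a long word in
  homogeneous elements many have the same degree, so the subwords between consecutive ones are
  elements of \<open>A 0\<close>, and sufficiently many of these stand side by side
  (lemma \<open>homogeneous_word_eq_zero\<close>). Since the homogeneous elements span the algebra, all
  long products vanish.
\<close>

section \<open>Identities of degree two\<close>

context assoc_algebra
begin

lemma degree2_identity_imp_quadratic_form_zero:
  assumes two: "(2::'f) \<noteq> 0" and B: "subspace B"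
    and identity: "\<And>a. \<forall>i\<in>{1..n}. a i \<in> B \<Longrightarrow> eval_quadratic n l c a = 0"
    and a: "\<forall>i\<in>{1..n}. a i \<in> B"
  shows "(\<Sum>r=1..n. \<Sum>s=1..n. l r s *s (a r * a s)) = 0" (is "?Q = 0")
proof -
  let ?L = "\<Sum>k=1..n. c k *s a k"
  have "\<forall>i\<in>{1..n}. - a i \<in> B"
    using a B by (simp add: subspace_neg)
  then have "eval_quadratic n l c (\<lambda>i. - a i) = 0"
    by (rule identity)
  then have minus: "?Q - ?L = 0"
    by (simp add: eval_quadratic_def sum_negf)
  have plus: "?Q + ?L = 0"
    using identity[OF a] by (simp add: eval_quadratic_def)
  have "2 *s ?Q = ?Q + ?Q"
    using scale_left_distrib[of 1 1 ?Q] by simp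
  also have "\<dots> = (?Q - ?L) + (?Q + ?L)"
    by simp
  finally have "2 *s ?Q = 0"
    using minus plus by simp
  then show ?thesis
    using two by simp
qed

lemma degree2_identity_imp_square_zero_or_commutative:
  assumes two: "(2::'f) \<noteq> 0" and B: "subspace B"
    and "satisfies_degree2_identity B"
  shows "(\<forall>x\<in>B. x * x = 0) \<or> (\<forall>x\<in>B. \<forall>y\<in>B. x * y = y * x)"
proof -
  obtain n l c r s where rs: "r \<in> {1..n}" "s \<in> {1..n}" "l r s \<noteq> 0"
    and identity: "\<And>a. \<forall>i\<in>{1..n}. a i \<in> B \<Longrightarrow> eval_quadratic n l c a = 0"
    using assms(3) unfolding satisfies_degree2_identity_def by blast
  note zero = degree2_identity_imp_quadratic_form_zero[OF two B identity]
  have zeroB: "0 \<in> B"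
    using B by (rule subspace_0)
  have diagonal: "l p p *s (x * x) = 0" if p: "p \<in> {1..n}" and x: "x \<in> B" for p x
  proof -
    let ?a = "\<lambda>i. if i = p then x else 0"
    have "(\<Sum>r=1..n. \<Sum>s=1..n. l r s *s (?a r * ?a s)) = (\<Sum>r\<in>{p}. \<Sum>s\<in>{p}. l r s *s (?a r * ?a s))"
      using p by (intro sum.mono_neutral_cong_right) (auto intro!: sum.neutral sum.mono_neutral_right)
    then show ?thesis
      using zero[of ?a] x zeroB by simp
  qed
  show ?thesis
  proof (cases "\<exists>p\<in>{1..n}. l p p \<noteq> 0")
    case True
    then show ?thesis
      using diagonal by (metis scale_eq_0_iff)
  next
    case False
    then have diag0: "l p p = 0" if "p \<in> {1..n}" for p
      using that by blast
    have "r \<noteq> s"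
      using rs diag0 by metis
    have mixed: "l r s *s (x * y) + l s r *s (y * x) = 0" if "x \<in> B" "y \<in> B" for x y
    proof -
      let ?a = "\<lambda>i. if i = r then x else if i = s then y else 0"
      have "(\<Sum>i=1..n. \<Sum>j=1..n. l i j *s (?a i * ?a j))
          = (\<Sum>i\<in>{r,s}. \<Sum>j\<in>{r,s}. l i j *s (?a i * ?a j))"
        using rs by (intro sum.mono_neutral_cong_right) (auto intro!: sum.neutral sum.mono_neutral_right)
      also have "\<dots> = l r s *s (x * y) + l s r *s (y * x)"
        using \<open>r \<noteq> s\<close> rs diag0 by simp
      finally show ?thesis
        using zero[of ?a] that zeroB by simp
    qed
    show ?thesis
    proof (cases "l r s + l s r = 0")
      case True
      then have "l s r = - l r s"
        by (simp add: add_eq_0_iff)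
      then have "l r s *s (x * y - y * x) = 0" if "x \<in> B" "y \<in> B" for x y
        using mixed[OF that] by (simp add: scale_right_diff_distrib)
      then have "\<forall>x\<in>B. \<forall>y\<in>B. x * y = y * x"
        using rs(3) by simp
      then show ?thesis ..
    next
      case False
      have "(l r s + l s r) *s (x * x) = 0" if "x \<in> B" for x
        using mixed[OF that that] by (simp add: scale_left_distrib)
      then show ?thesis
        using False by simp
    qed
  qed
qed

text \<open>
  Anticommutativity moves \<open>z\<close> to the front of \<open>x * y * z\<close> at once, with one sign, or by cyclic
  rotation in two steps, with two signs.
\<close>

lemma square_zero_imp_triple_product_zero:
  assumes two: "(2::'f) \<noteq> 0" and B: "subspace B"
    and mult: "\<And>x y. x \<in> B \<Longrightarrow> y \<in> B \<Longrightarrow> x * y \<in> B"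
    and square: "\<And>x. x \<in> B \<Longrightarrow> x * x = 0"
    and xyz: "x \<in> B" "y \<in> B" "z \<in> B"
  shows "x * y * z = 0"
proof -
  have anti: "u * v = - (v * u)" if "u \<in> B" "v \<in> B" for u v
  proof -
    have "(u + v) * (u + v) = 0"
      using that B by (intro square subspace_add)
    then show ?thesis
      using square that by (simp add: algebra_simps add_eq_0_iff)
  qed
  have "x * y * z = - (y * (z * x))"
    using anti[of x "y * z"] mult xyz by (simp add: mult.assoc)
  also have "\<dots> = z * (x * y)"
    using anti[of y "z * x"] mult xyz by (simp add: mult.assoc)
  also have "\<dots> = - (x * y * z)"
    using anti[of z "x * y"] mult xyz by simp
  finally have "x * y * z + x * y * z = 0"
    by (simp add: eq_neg_iff_add_eq_0)
  then have "2 *s (x * y * z) = 0"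
    using scale_left_distrib[of 1 1 "x * y * z"] by simp
  then show ?thesis
    using two by simp
qed

end

section \<open>From a nilpotent neutral component to a nilpotent algebra\<close>

context graded_algebra
begin

text \<open>
  Words remember the degrees of their letters, since the degree of the zero element is not
  determined by the element.
\<close>

definition homogeneous_word :: "('g \<times> 'a) list \<Rightarrow> bool" where
  "homogeneous_word w \<longleftrightarrow> (\<forall>(g, x)\<in>set w. x \<in> A g)"

definition word_degree :: "('g \<times> 'a) list \<Rightarrow> 'g" where
  "word_degree w = sum_list (map fst w)"

text \<open>
  As there is no unit, the empty word has no value; words are therefore treated as operators acting
  by multiplication from the right, and the empty word is the identity operator.
\<close>

definition act :: "'a \<Rightarrow> ('g \<times> 'a) list \<Rightarrow> 'a" where
  "act y w = foldl (*) y (map snd w)"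

lemma act_simps [simp]:
  "act y [] = y"
  "act y (p # w) = act (y * snd p) w"
  "act y (v @ w) = act (act y v) w"
  by (simp_all add: act_def)

lemma act_zero [simp]: "act 0 w = 0"
  by (induction w) auto

lemma homogeneous_word_simps [simp]:
  "homogeneous_word []"
  "homogeneous_word (p # w) \<longleftrightarrow> snd p \<in> A (fst p) \<and> homogeneous_word w"
  "homogeneous_word (v @ w) \<longleftrightarrow> homogeneous_word v \<and> homogeneous_word w"
  by (auto simp: homogeneous_word_def split: prod.splits)

lemma word_degree_simps [simp]:
  "word_degree [] = 0"
  "word_degree (p # w) = fst p + word_degree w"
  "word_degree (v @ w) = word_degree v + word_degree w"
  by (simp_all add: word_degree_def)

lemma act_eq_mult_homogeneous:
  assumes "homogeneous_word w" "w \<noteq> []"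
  shows "\<exists>p\<in>A (word_degree w). \<forall>y. act y w = y * p"
  using assms(2,1)
proof (induction w rule: list_nonempty_induct)
  case (single q)
  then show ?case by auto
next
  case (cons q w)
  then obtain p where p: "p \<in> A (word_degree w)" "\<And>y. act y w = y * p"
    by auto
  have "snd q * p \<in> A (word_degree (q # w))"
    using mult_component[of "snd q" "fst q" p "word_degree w"] cons.prems p(1) by simp
  then show ?case
    using p(2) by (auto simp: mult.assoc)
qed

text \<open>
  If \<open>m + 1\<close> prefixes have the same degree, the \<open>m\<close> subwords between consecutive ends of these
  prefixes have degree \<open>0\<close>, so each of them acts as an element of \<open>A 0\<close>. The word \<open>v\<close> arises
  as the shortest of the prefixes.
\<close>

lemma equal_degree_prefixes_factorization:
  assumes "homogeneous_word w" "I \<subseteq> {..length w}" "card I = Suc m"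
    and "\<And>i. i \<in> I \<Longrightarrow> word_degree (take i w) = g"
  shows "\<exists>v us. set us \<subseteq> A 0 \<and> length us = m \<and>
    (\<forall>y. act y (take (Max I) w) = foldl (*) (act y v) us)"
  using assms(2-)
proof (induction m arbitrary: I)
  case 0
  show ?case
    by (intro exI[of _ "take (Max I) w"] exI[of _ "[]"]) simp
next
  case (Suc m)
  define i where "i = Max I"
  define J where "J = I - {i}"
  define j where "j = Max J"
  have fin: "finite I"
    using Suc.prems(1) finite_subset by blast
  have "I \<noteq> {}"
    using Suc.prems(2) by auto
  then have i: "i \<in> I"
    using fin by (simp add: i_def)
  then have card_J: "card J = Suc m"
    using Suc.prems(2) fin by (simp add: J_def)
  then have "J \<noteq> {}"
    by auto
  then have "j \<in> J"
    using fin Max_in[of J] by (simp add: j_def J_def)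
  then have j: "j \<in> I" "j < i"
    using Max_ge[OF fin, of j] by (auto simp: J_def i_def less_le)
  have "J \<subseteq> {..length w}" and "\<And>k. k \<in> J \<Longrightarrow> word_degree (take k w) = g"
    using Suc.prems(1,3) by (auto simp: J_def)
  then obtain v us where us: "set us \<subseteq> A 0" "length us = m"
    and act_j: "\<And>y. act y (take j w) = foldl (*) (act y v) us"
    using Suc.IH[OF _ card_J] unfolding j_def by blast
  define b where "b = drop j (take i w)"
  have take_i: "take i w = take j w @ b"
    using j(2) append_take_drop_id[of j "take i w"] by (simp add: b_def min_def)
  have "homogeneous_word (take i w)"
    using assms(1) by (metis append_take_drop_id homogeneous_word_simps(3))
  then have "homogeneous_word b"
    by (simp add: take_i)
  moreover have "b \<noteq> []"
    using i j(2) Suc.prems(1) by (auto simp: b_def)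
  moreover have "word_degree b = 0"
    using Suc.prems(3)[OF i] Suc.prems(3)[OF j(1)] by (simp add: take_i)
  ultimately obtain p where p: "p \<in> A 0" "\<And>y. act y b = y * p"
    using act_eq_mult_homogeneous by metis
  have "act y (take i w) = foldl (*) (act y v) (us @ [p])" for y
    by (simp add: take_i act_j p(2))
  then show ?case
    using us p(1) unfolding i_def by (intro exI[of _ v] exI[of _ "us @ [p]"]) auto
qed

lemma homogeneous_word_eq_zero:
  assumes nil: "\<And>y us. set us \<subseteq> A 0 \<Longrightarrow> length us = m \<Longrightarrow> foldl (*) y us = 0"
    and w: "homogeneous_word w" "length w = m * card (UNIV :: 'g set)"
  shows "act y w = 0"
proof -
  let ?D = "\<lambda>i. word_degree (take i w)"
  let ?P = "{..length w}"
  \<comment> \<open>With the empty one there is one prefix more than \<open>m\<close> for each degree, so \<open>m + 1\<close> of them share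
    a degree.\<close>
  obtain g where "card ?P \<le> card (?D -` {g} \<inter> ?P) * card (UNIV :: 'g set)"
    using pigeonhole_card[of ?D ?P UNIV] by auto
  then have "m * card (UNIV :: 'g set) < card (?D -` {g} \<inter> ?P) * card (UNIV :: 'g set)"
    by (simp only: w(2) card_atMost Suc_le_eq)
  then have "Suc m \<le> card (?D -` {g} \<inter> ?P)"
    unfolding mult_less_cancel2 by (simp only: Suc_le_eq)
  then obtain I where I: "I \<subseteq> ?D -` {g} \<inter> ?P" "card I = Suc m"
    by (meson obtain_subset_with_card_n)
  then have "I \<subseteq> ?P" and "\<And>i. i \<in> I \<Longrightarrow> ?D i = g"
    by auto
  then obtain v us where "set us \<subseteq> A 0" "length us = m"
    and "\<And>y. act y (take (Max I) w) = foldl (*) (act y v) us"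
    using equal_degree_prefixes_factorization[OF w(1) _ I(2)] by metis
  then have "act y (take (Max I) w) = 0"
    using nil by simp
  then have "act y (take (Max I) w @ drop (Max I) w) = 0"
    unfolding act_simps by simp
  then show ?thesis
    by simp
qed

text \<open>
  Splitting the last factor of a product into its homogeneous components turns it into a sum of
  products that end with a homogeneous letter. The first factor stays arbitrary: it is what the
  words act on.
\<close>

lemma alg_power_subset_span_words:
  "alg_power (Suc k) \<subseteq> span {act y w | y w. homogeneous_word w \<and> length w = k}"
proof (induction k)
  case 0
  show ?case
    by (auto intro!: span_base)
next
  case (Suc k)
  let ?W = "\<lambda>k. {act y w | y w. homogeneous_word w \<and> length w = k}"
  have homogeneous: "x * z \<in> span (?W (Suc k))" if x: "x \<in> span (?W k)" and z: "z \<in> A g" for x z g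
    using x
  proof (induction rule: span_induct_alt)
    case base
    then show ?case
      by (simp add: span_zero)
  next
    case (step c u x)
    then obtain y w where w: "u = act y w" "homogeneous_word w" "length w = k"
      by auto
    then have "u * z = act y (w @ [(g, z)])" "homogeneous_word (w @ [(g, z)])"
      "length (w @ [(g, z)]) = Suc k"
      using z by auto
    then have "u * z \<in> span (?W (Suc k))"
      by (intro span_base) blast
    then show ?case
      using step by (simp add: distrib_right scale_mult_left span_add span_scale)
  qed
  have "x * z \<in> span (?W (Suc k))" if "x \<in> alg_power (Suc k)" for x z
  proof -
    obtain f where f: "\<And>g. f g \<in> A g" "z = (\<Sum>g\<in>UNIV. f g)"
      using direct_sum[of z] by blast
    have "x \<in> span (?W k)"
      using that Suc.IH by blast
    then have "(\<Sum>g\<in>UNIV. x * f g) \<in> span (?W (Suc k))"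
      using homogeneous f(1) by (intro span_sum) blast
    then show ?thesis
      by (simp add: f(2) sum_distrib_left)
  qed
  then have "{x * z | x z. x \<in> alg_power (Suc k) \<and> z \<in> UNIV} \<subseteq> span (?W (Suc k))"
    by blast
  then show ?case
    by (simp add: span_minimal)
qed

lemma nilpotent_if_component_zero_nilpotent:
  assumes "\<And>y us. set us \<subseteq> A 0 \<Longrightarrow> length us = m \<Longrightarrow> foldl (*) y us = 0"
  shows nilpotent
proof -
  let ?k = "m * card (UNIV :: 'g set)"
  have "{act y w | y w. homogeneous_word w \<and> length w = ?k} \<subseteq> {0}"
    using homogeneous_word_eq_zero[OF assms] by blast
  then have "span {act y w | y w. homogeneous_word w \<and> length w = ?k} \<subseteq> {0}"
    by (simp add: span_minimal)
  then have "alg_power (Suc ?k) \<subseteq> {0}"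
    using alg_power_subset_span_words by blast
  moreover have "0 \<in> alg_power (Suc ?k)"
    by (cases ?k) (simp_all add: span_zero)
  ultimately have "alg_power (Suc ?k) = {0}"
    by blast
  then show ?thesis
    unfolding nilpotent_def by (intro exI[of _ "Suc ?k"]) simp
qed

end

section \<open>The dichotomy\<close>

theorem corollary3p4:
  fixes scale :: "'f :: {alg_closed_field, field_char_0} \<Rightarrow> 'a :: ring \<Rightarrow> 'a"
    and A :: "'g :: {ab_group_add, finite} \<Rightarrow> 'a set"
  assumes "graded_algebra scale A"
    and "assoc_algebra.satisfies_degree2_identity scale (A 0)"
  shows "assoc_algebra.nilpotent scale \<or> (\<forall>x\<in>A 0. \<forall>y\<in>A 0. x * y = y * x)"
proof -
  interpret graded_algebra scale A
    by (fact assms(1))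
  have two: "(2::'f) \<noteq> 0"
    by simp
  have mult: "x * y \<in> A 0" if "x \<in> A 0" "y \<in> A 0" for x y
    using mult_component[OF that] by simp
  consider (square) "\<forall>x\<in>A 0. x * x = 0" | (commutative) "\<forall>x\<in>A 0. \<forall>y\<in>A 0. x * y = y * x"
    using degree2_identity_imp_square_zero_or_commutative[OF two subspace_component assms(2)]
    by blast
  then show ?thesis
  proof cases
    case square
    have triple: "x * y * z = 0" if "x \<in> A 0" "y \<in> A 0" "z \<in> A 0" for x y z
      using square_zero_imp_triple_product_zero[OF two subspace_component mult] square that
      by blast
    have "foldl (*) y us = 0" if us: "set us \<subseteq> A 0" "length us = 3" for y us
    proof -
      obtain u v w where "us = [u, v, w]"
        using us(2) by (auto simp: numeral_3_eq_3 length_Suc_conv)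
      then show ?thesis
        using us(1) triple[of u v w] by (simp add: mult.assoc)
    qed
    then show ?thesis
      using nilpotent_if_component_zero_nilpotent by blast
  next
    case commutative
    then show ?thesis ..
  qed
qed

end
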